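(* Let $P$ be a ring. The class of all rings of the form $\mathrm{M}_\Lambda(P)$, for $\Lambda$ a locally finite poset, is generated by the rings $\mathrm{M}_{\mathbf{m}\leftarrow\mathbf{n}}(P)$, $m,n\in\mathbb{N}$, under products, inverse limits and pullbacks; that is, every such $\mathrm{M}_\Lambda(P)$ belongs to the smallest class of rings that contains all $\mathrm{M}_{\mathbf{m}\leftarrow\mathbf{n}}(P)$ and is closed under isomorphism, products, inverse limits and pullbacks.
   Context: Rings are associative with identity and ring homomorphisms preserve the identity. A proset is a preordered set, a poset is a partially ordered set; for $s_1\preceq s_2$, $[s_1,s_2]=\{s: s_1\preceq s\preceq s_2\}$, and a proset is locally finite if all such intervals are finite. For a locally finite proset $\Lambda$, the incidence ring is $\mathrm{M}_\Lambda(P)=\{(a_{s_1,s_2})\in P^{\Lambda\times\Lambda}: a_{s_1,s_2}\neq 0\Rightarrow s_1\preceq s_2\}$ with coordinatewise addition and product $(ab)_{s_1,s_2}=\sum_{t\in[s_1,s_2]}a_{s_1,t}b_{t,s_2}$ ($\mathrm{M}_\emptyset(P)$ is the trivial ring). For $m,n\in\mathbb{N}$ (including $0$), $\mathbf{m}\leftarrow\mathbf{n}$ is the proset with elements $\{0',\dots,(m-1)',0,\dots,n-1\}$ in which all the primed elements are equivalent to each other, all the unprimed elements are equivalent to each other, and every primed element is below every unprimed element (and no unprimed element is below a primed one). *)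

theory Defs
  imports "HOL-Algebra.Algebra" "HOL-Library.Equipollence"
begin

text \<open>
  A proset is given by a carrier set \<open>\<Lambda>\<close> and a relation \<open>r\<close> with \<open>preorder_on \<Lambda> r\<close>; a poset is
  one with \<open>partial_order_on \<Lambda> r\<close>. Here \<open>(s, t) \<in> r\<close> means that \<open>s\<close> is below \<open>t\<close>.
\<close>

definition proset_interval :: "'l set \<Rightarrow> 'l rel \<Rightarrow> 'l \<Rightarrow> 'l \<Rightarrow> 'l set" where
  "proset_interval \<Lambda> r s t = {u \<in> \<Lambda>. (s, u) \<in> r \<and> (u, t) \<in> r}"

definition locally_finite :: "'l set \<Rightarrow> 'l rel \<Rightarrow> bool" where
  "locally_finite \<Lambda> r \<longleftrightarrow> (\<forall>(s, t) \<in> r. finite (proset_interval \<Lambda> r s t))"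

definition incidence_ring ::
    "'l set \<Rightarrow> 'l rel \<Rightarrow> ('p, 'm) ring_scheme \<Rightarrow> ('l \<times> 'l \<Rightarrow> 'p) ring" where
  "incidence_ring \<Lambda> r P =
    \<lparr> carrier = {a \<in> \<Lambda> \<times> \<Lambda> \<rightarrow>\<^sub>E carrier P.
                   \<forall>s\<in>\<Lambda>. \<forall>t\<in>\<Lambda>. a (s, t) \<noteq> \<zero>\<^bsub>P\<^esub> \<longrightarrow> (s, t) \<in> r},
      monoid.mult = (\<lambda>a b. \<lambda>(s, t)\<in>\<Lambda> \<times> \<Lambda>.
                \<Oplus>\<^bsub>P\<^esub> u \<in> proset_interval \<Lambda> r s t. a (s, u) \<otimes>\<^bsub>P\<^esub> b (u, t)),
      one = (\<lambda>(s, t)\<in>\<Lambda> \<times> \<Lambda>. if s = t then \<one>\<^bsub>P\<^esub> else \<zero>\<^bsub>P\<^esub>),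
      ring.zero = (\<lambda>_\<in>\<Lambda> \<times> \<Lambda>. \<zero>\<^bsub>P\<^esub>),
      add = (\<lambda>a b. \<lambda>x\<in>\<Lambda> \<times> \<Lambda>. a x \<oplus>\<^bsub>P\<^esub> b x) \<rparr>"

text \<open>
  The proset \<open>m \<leftarrow> n\<close>: \<open>Inl i\<close> with \<open>i < m\<close> is the primed element \<open>i'\<close>, and \<open>Inr j\<close> with
  \<open>j < n\<close> is the unprimed element \<open>j\<close>.
\<close>

definition arrow_carrier :: "nat \<Rightarrow> nat \<Rightarrow> (nat + nat) set" where
  "arrow_carrier m n = Inl ` {..<m} \<union> Inr ` {..<n}"

definition arrow_rel :: "nat \<Rightarrow> nat \<Rightarrow> (nat + nat) rel" where
  "arrow_rel m n = Inl ` {..<m} \<times> Inl ` {..<m}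
                 \<union> Inr ` {..<n} \<times> Inr ` {..<n}
                 \<union> Inl ` {..<m} \<times> Inr ` {..<n}"

definition product_ring :: "'i set \<Rightarrow> ('i \<Rightarrow> ('a, 'm) ring_scheme) \<Rightarrow> ('i \<Rightarrow> 'a) ring" where
  "product_ring I F =
    \<lparr> carrier = (\<Pi>\<^sub>E i\<in>I. carrier (F i)),
      monoid.mult = (\<lambda>x y. \<lambda>i\<in>I. x i \<otimes>\<^bsub>F i\<^esub> y i),
      one = (\<lambda>i\<in>I. \<one>\<^bsub>F i\<^esub>),
      ring.zero = (\<lambda>i\<in>I. \<zero>\<^bsub>F i\<^esub>),
      add = (\<lambda>x y. \<lambda>i\<in>I. x i \<oplus>\<^bsub>F i\<^esub> y i) \<rparr>"

definition directed_poset :: "'i set \<Rightarrow> 'i rel \<Rightarrow> bool" where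
  "directed_poset I leq \<longleftrightarrow>
     partial_order_on I leq \<and> I \<noteq> {} \<and> (\<forall>i\<in>I. \<forall>j\<in>I. \<exists>k\<in>I. (i, k) \<in> leq \<and> (j, k) \<in> leq)"

text \<open>The connecting map for \<open>(i, j) \<in> leq\<close> is \<open>\<phi> i j\<close>, from \<open>F j\<close> to \<open>F i\<close>.\<close>

definition inverse_system ::
    "'i set \<Rightarrow> 'i rel \<Rightarrow> ('i \<Rightarrow> ('a, 'm) ring_scheme) \<Rightarrow> ('i \<Rightarrow> 'i \<Rightarrow> 'a \<Rightarrow> 'a) \<Rightarrow> bool" where
  "inverse_system I leq F \<phi> \<longleftrightarrow>
     directed_poset I leq \<and>
     (\<forall>i\<in>I. ring (F i)) \<and>
     (\<forall>(i, j)\<in>leq. \<phi> i j \<in> ring_hom (F j) (F i)) \<and>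
     (\<forall>i\<in>I. \<forall>x\<in>carrier (F i). \<phi> i i x = x) \<and>
     (\<forall>i j k. (i, j) \<in> leq \<longrightarrow> (j, k) \<in> leq \<longrightarrow>
        (\<forall>x\<in>carrier (F k). \<phi> i j (\<phi> j k x) = \<phi> i k x))"

definition inverse_limit_ring ::
    "'i set \<Rightarrow> 'i rel \<Rightarrow> ('i \<Rightarrow> ('a, 'm) ring_scheme) \<Rightarrow> ('i \<Rightarrow> 'i \<Rightarrow> 'a \<Rightarrow> 'a) \<Rightarrow> ('i \<Rightarrow> 'a) ring"
  where
  "inverse_limit_ring I leq F \<phi> =
    (product_ring I F)
      \<lparr> carrier := {x \<in> carrier (product_ring I F). \<forall>(i, j)\<in>leq. \<phi> i j (x j) = x i} \<rparr>"

definition pullback_ring ::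
    "('a, 'm) ring_scheme \<Rightarrow> ('b, 'n) ring_scheme \<Rightarrow> ('a \<Rightarrow> 'c) \<Rightarrow> ('b \<Rightarrow> 'c) \<Rightarrow> ('a \<times> 'b) ring"
  where
  "pullback_ring A B f g =
    (RDirProd A B) \<lparr> carrier := {(a, b). a \<in> carrier A \<and> b \<in> carrier B \<and> f a = g b} \<rparr>"

text \<open>
  A class of rings has to be a set of rings with carriers in one fixed type. The type
  \<open>'k \<Rightarrow> 'p\<close> is used, and products and inverse limits are indexed by subsets of \<open>'k\<close>.
  When \<open>'k\<close> is infinite, \<open>'k \<Rightarrow> ('k \<Rightarrow> 'p)\<close> and \<open>('k \<Rightarrow> 'p) \<times> ('k \<Rightarrow> 'p)\<close> inject into
  \<open>'k \<Rightarrow> 'p\<close>, so every product, inverse limit and pullback mentioned below has an isomorphic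
  copy in this type, as does every incidence ring over a ring in \<open>'p\<close> of a proset that
  injects into \<open>'k\<close>. Constructions that live in another type enter a class through all
  their copies.
\<close>

type_synonym ('k, 'p) ring_class = "('k \<Rightarrow> 'p) ring set"

definition copies :: "('a, 'm) ring_scheme \<Rightarrow> ('k, 'p) ring_class" where
  "copies S = {R. ring R \<and> R \<simeq> S}"

definition closed_under_iso :: "('k, 'p) ring_class \<Rightarrow> bool" where
  "closed_under_iso C \<longleftrightarrow> (\<forall>R\<in>C. copies R \<subseteq> C)"

definition closed_under_products :: "('k, 'p) ring_class \<Rightarrow> bool" where
  "closed_under_products C \<longleftrightarrow>
     (\<forall>(I :: 'k set) F. (\<forall>i\<in>I. F i \<in> C) \<longrightarrow> copies (product_ring I F) \<subseteq> C)"

definition closed_under_inverse_limits :: "('k, 'p) ring_class \<Rightarrow> bool" where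
  "closed_under_inverse_limits C \<longleftrightarrow>
     (\<forall>(I :: 'k set) leq F \<phi>. inverse_system I leq F \<phi> \<longrightarrow> (\<forall>i\<in>I. F i \<in> C) \<longrightarrow>
        copies (inverse_limit_ring I leq F \<phi>) \<subseteq> C)"

definition closed_under_pullbacks :: "('k, 'p) ring_class \<Rightarrow> bool" where
  "closed_under_pullbacks C \<longleftrightarrow>
     (\<forall>A\<in>C. \<forall>B\<in>C. \<forall>D\<in>C. \<forall>f\<in>ring_hom A D. \<forall>g\<in>ring_hom B D.
        copies (pullback_ring A B f g) \<subseteq> C)"

definition generated_class :: "('k, 'p) ring_class \<Rightarrow> ('k, 'p) ring_class" where
  "generated_class G =
     \<Inter> {C. C \<subseteq> {R. ring R} \<and> G \<subseteq> C \<and> closed_under_iso C \<and> closed_under_products C \<and>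
           closed_under_inverse_limits C \<and> closed_under_pullbacks C}"

definition arrow_incidence_rings :: "('p, 'm) ring_scheme \<Rightarrow> ('k, 'p) ring_class" where
  "arrow_incidence_rings P =
     (\<Union>m. \<Union>n. copies (incidence_ring (arrow_carrier m n) (arrow_rel m n) P))"

end

theory Submission
  imports Defs
begin

text \<open>
  For a finite set \<open>C\<close> with a preorder \<open>r\<close>, a matrix over \<open>C\<close> is supported on \<open>r\<close> iff for every
  \<open>x \<in> C\<close> it is block triangular with respect to the up-set \<open>{t. (x, t) \<in> r}\<close> and its complement.
  Each of these block conditions defines a copy of some \<open>M\<^bsub>m \<leftarrow> n\<^esub>(P)\<close> inside the full matrix ring
  over \<open>C\<close>, and intersections of subrings are pullbacks. An arbitrary locally finite
  \<open>\<Lambda>\<close> is the directed union of its finite convex subsets, and the incidence ring of \<open>\<Lambda>\<close> is the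
  inverse limit of theirs along restriction.
\<close>

section \<open>Copies of rings in a closed class\<close>

text \<open>Principal up-sets suffice because \<open>(s, t) \<in> r\<close> holds exactly when every
  principal up-set containing \<open>s\<close> also contains \<open>t\<close>; over a finite set
  these are finitely many conditions, hence finitely many pullbacks. For infinite \<Lambda> there is
  in general no ring of all matrices over \<Lambda> in which to intersect, since its product would
  need infinite sums; this forces the passage to finite pieces. The pieces are convex so that
  restriction respects products: every index that occurs between two elements of a piece is itself
  in the piece. Local finiteness puts each finite set inside a finite convex one. The other obstacle
  is size. Members of a class live in \<open>'k \<Rightarrow> 'p\<close> and index sets in
  \<open>'k\<close>, so rings are handled up to isomorphism, and finite convex subsets are coded by
  elements of \<open>'k\<close>. The code exists because an infinite set has as many finite subsets
  as elements.\<close>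

lemma copies_nonempty:
  assumes "ring S" and "carrier S \<lesssim> (UNIV :: ('k \<Rightarrow> 'p) set)"
  shows "(copies S :: ('k, 'p) ring_class) \<noteq> {}"
proof -
  obtain f :: "_ \<Rightarrow> 'k \<Rightarrow> 'p" where f: "inj_on f (carrier S)"
    using assms(2) by (auto simp: lepoll_def)
  have iso: "f \<in> ring_iso S (image_ring f S)"
    by (rule inj_imp_image_ring_iso[OF f])
  have "ring (image_ring f S)"
    by (rule ring.inj_imp_image_ring_is_ring[OF assms(1) f])
  moreover have "image_ring f S \<simeq> S"
    using ring_iso_sym[OF assms(1)] iso by (auto simp: is_ring_iso_def)
  ultimately show ?thesis
    by (auto simp: copies_def)
qed

text \<open>\<open>K\<close> stands for any one of the classes whose intersection is
  \<open>generated_class\<close>.\<close>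

locale limit_closed_class =
  fixes K :: "('k, 'p) ring_class"
  assumes rings: "R \<in> K \<Longrightarrow> ring R"
    and inverse_limits: "closed_under_inverse_limits K"
    and pullbacks: "closed_under_pullbacks K"
begin

text \<open>Lets the argument speak of rings in whatever type they naturally live, such as matrices
  on \<Lambda> \<times> \<Lambda>, although the members of \<open>K\<close> have a fixed carrier
  type.\<close>

definition has_copy :: "('a, 'm) ring_scheme \<Rightarrow> bool" where
  "has_copy S \<longleftrightarrow> (\<exists>R\<in>K. R \<simeq> S)"

lemma has_copy_iso: "has_copy S \<Longrightarrow> S \<simeq> S' \<Longrightarrow> has_copy S'"
  unfolding has_copy_def by (blast intro: ring_iso_trans)

section \<open>Recognizing pullbacks and inverse limits up to isomorphism\<close>

lemma has_copyE:
  assumes "has_copy S"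
  obtains R \<alpha> \<beta> where "R \<in> K" "\<alpha> \<in> ring_iso R S" "\<beta> \<in> ring_iso S R"
    "\<And>x. x \<in> carrier R \<Longrightarrow> \<beta> (\<alpha> x) = x" "\<And>y. y \<in> carrier S \<Longrightarrow> \<alpha> (\<beta> y) = y"
proof -
  obtain R \<alpha> where R: "R \<in> K" and \<alpha>: "\<alpha> \<in> ring_iso R S"
    using assms by (auto simp: has_copy_def is_ring_iso_def)
  have "bij_betw \<alpha> (carrier R) (carrier S)"
    using \<alpha> by (simp add: ring_iso_def)
  then show thesis
    using that[OF R \<alpha> ring_iso_set_sym[OF rings[OF R] \<alpha>]]
    by (simp add: bij_betw_inv_into_left bij_betw_inv_into_right)
qed

text \<open>\<open>S\<close> is recognized as a pullback by its two projections: they are jointly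
  injective and reach every compatible pair. The rings involved may lie in different types;
  replacing them by members of \<open>K\<close> turns the square into one to which closure of
  \<open>K\<close> applies.\<close>

lemma has_copy_pullback:
  assumes S: "ring S" "carrier S \<lesssim> (UNIV :: ('k \<Rightarrow> 'p) set)"
    and copy: "has_copy A" "has_copy B" "has_copy D"
    and f: "f \<in> ring_hom A D" and g: "g \<in> ring_hom B D"
    and p: "p \<in> ring_hom S A" and q: "q \<in> ring_hom S B"
    and commute: "\<And>x. x \<in> carrier S \<Longrightarrow> f (p x) = g (q x)"
    and inj: "\<And>x y. x \<in> carrier S \<Longrightarrow> y \<in> carrier S \<Longrightarrow> p x = p y \<Longrightarrow> q x = q y \<Longrightarrow> x = y"
    and surj: "\<And>a b. a \<in> carrier A \<Longrightarrow> b \<in> carrier B \<Longrightarrow> f a = g b \<Longrightarrow>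
      \<exists>x\<in>carrier S. p x = a \<and> q x = b"
  shows "has_copy S"
proof -
  obtain A0 \<alpha> \<alpha>' where A0: "A0 \<in> K" "\<alpha> \<in> ring_iso A0 A" "\<alpha>' \<in> ring_iso A A0"
    "\<And>x. x \<in> carrier A0 \<Longrightarrow> \<alpha>' (\<alpha> x) = x" "\<And>y. y \<in> carrier A \<Longrightarrow> \<alpha> (\<alpha>' y) = y"
    using has_copyE[OF copy(1)] by metis
  obtain B0 \<beta> \<beta>' where B0: "B0 \<in> K" "\<beta> \<in> ring_iso B0 B" "\<beta>' \<in> ring_iso B B0"
    "\<And>x. x \<in> carrier B0 \<Longrightarrow> \<beta>' (\<beta> x) = x" "\<And>y. y \<in> carrier B \<Longrightarrow> \<beta> (\<beta>' y) = y"
    using has_copyE[OF copy(2)] by metis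
  obtain D0 \<delta> \<delta>' where D0: "D0 \<in> K" "\<delta> \<in> ring_iso D0 D" "\<delta>' \<in> ring_iso D D0"
    "\<And>x. x \<in> carrier D0 \<Longrightarrow> \<delta>' (\<delta> x) = x" "\<And>y. y \<in> carrier D \<Longrightarrow> \<delta> (\<delta>' y) = y"
    using has_copyE[OF copy(3)] by metis
  note A0m = ring_iso_memE[OF A0(2)] ring_iso_memE[OF A0(3)]
  note B0m = ring_iso_memE[OF B0(2)] ring_iso_memE[OF B0(3)]
  note D0m = ring_iso_memE[OF D0(2)] ring_iso_memE[OF D0(3)]
  note fm = ring_hom_memE[OF f] note gm = ring_hom_memE[OF g]
  note pm = ring_hom_memE[OF p] note qm = ring_hom_memE[OF q]
  \<comment> \<open>The maps to \<open>D\<close>, conjugated by the chosen isomorphisms, become maps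
    between members of \<open>K\<close>.\<close>
  define f0 where "f0 = (\<lambda>x. \<delta>' (f (\<alpha> x)))"
  define g0 where "g0 = (\<lambda>x. \<delta>' (g (\<beta> x)))"
  define e where "e = (\<lambda>x. (\<alpha>' (p x), \<beta>' (q x)))"
  have f0: "f0 \<in> ring_hom A0 D0"
    by (rule ring_hom_memI) (simp_all add: f0_def A0m D0m fm)
  have g0: "g0 \<in> ring_hom B0 D0"
    by (rule ring_hom_memI) (simp_all add: g0_def B0m D0m gm)
  have iso: "e \<in> ring_iso S (pullback_ring A0 B0 f0 g0)"
  proof (rule ring_iso_memI)
    fix x assume "x \<in> carrier S"
    then show "e x \<in> carrier (pullback_ring A0 B0 f0 g0)"
      by (simp add: e_def pullback_ring_def f0_def g0_def A0m B0m A0(5) B0(5) pm qm commute)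
  next
    fix x y assume "x \<in> carrier S" "y \<in> carrier S"
    then show "e (x \<otimes>\<^bsub>S\<^esub> y) = e x \<otimes>\<^bsub>pullback_ring A0 B0 f0 g0\<^esub> e y"
      "e (x \<oplus>\<^bsub>S\<^esub> y) = e x \<oplus>\<^bsub>pullback_ring A0 B0 f0 g0\<^esub> e y"
      by (simp_all add: e_def pullback_ring_def RDirProd_def DirProd_def monoid.defs A0m B0m pm qm)
  next
    show "e \<one>\<^bsub>S\<^esub> = \<one>\<^bsub>pullback_ring A0 B0 f0 g0\<^esub>"
      by (simp add: e_def pullback_ring_def RDirProd_def DirProd_def monoid.defs A0m B0m pm qm)
  next
    show "bij_betw e (carrier S) (carrier (pullback_ring A0 B0 f0 g0))"
    proof (rule bij_betw_imageI)
      show "inj_on e (carrier S)"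
      proof (rule inj_onI)
        fix x y assume xy: "x \<in> carrier S" "y \<in> carrier S" "e x = e y"
        then have "\<alpha> (\<alpha>' (p x)) = \<alpha> (\<alpha>' (p y))" "\<beta> (\<beta>' (q x)) = \<beta> (\<beta>' (q y))"
          by (simp_all add: e_def)
        then show "x = y"
          using xy by (intro inj) (simp_all add: A0(5) B0(5) pm qm)
      qed
      show "e ` carrier S = carrier (pullback_ring A0 B0 f0 g0)"
      proof (intro equalityI subsetI)
        fix z assume "z \<in> e ` carrier S"
        then show "z \<in> carrier (pullback_ring A0 B0 f0 g0)"
          by (auto simp: e_def pullback_ring_def f0_def g0_def A0m B0m A0(5) B0(5) pm qm commute)
      next
        fix z assume "z \<in> carrier (pullback_ring A0 B0 f0 g0)"
        then obtain a b where z: "z = (a, b)" "a \<in> carrier A0" "b \<in> carrier B0" "f0 a = g0 b"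
          by (auto simp: pullback_ring_def)
        \<comment> \<open>Applying \<delta> cancels the \<delta>' in \<open>f0\<close> and
          \<open>g0\<close>, so compatibility in \<open>K\<close> becomes compatibility for
          \<open>f\<close> and \<open>g\<close>.\<close>
        have "\<delta> (f0 a) = \<delta> (g0 b)"
          using z by simp
        then have "f (\<alpha> a) = g (\<beta> b)"
          using z by (simp add: f0_def g0_def D0(5) A0m B0m fm gm)
        then obtain x where "x \<in> carrier S" "p x = \<alpha> a" "q x = \<beta> b"
          using surj[of "\<alpha> a" "\<beta> b"] z A0m B0m by metis
        then show "z \<in> e ` carrier S"
          using z by (auto simp: e_def A0(4) B0(4) intro!: image_eqI[of _ _ x])
      qed
    qed
  qed
  obtain S0 :: "('k \<Rightarrow> 'p) ring" where S0: "ring S0" "S0 \<simeq> S"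
    using copies_nonempty[OF S] by (auto simp: copies_def)
  have "S0 \<simeq> pullback_ring A0 B0 f0 g0"
    using S0(2) iso by (auto simp: is_ring_iso_def dest: ring_iso_set_trans)
  then have "S0 \<in> copies (pullback_ring A0 B0 f0 g0)"
    using S0(1) by (simp add: copies_def)
  then have "S0 \<in> K"
    using pullbacks A0(1) B0(1) D0(1) f0 g0 unfolding closed_under_pullbacks_def by blast
  then show ?thesis
    using S0(2) by (auto simp: has_copy_def)
qed

text \<open>The same recognition principle for a directed system: the projections \<open>p i\<close>
  separate the points of \<open>S\<close> and reach every compatible family. Replacing each
  \<open>A i\<close> by a member of \<open>K\<close> and conjugating the connecting maps gives an
  inverse system inside \<open>K\<close>.\<close>

lemma has_copy_inverse_limit:
  fixes I :: "'k set" and S :: "('s, 'n) ring_scheme" and A :: "'k \<Rightarrow> ('a, 'm) ring_scheme"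
  assumes S: "ring S" "carrier S \<lesssim> (UNIV :: ('k \<Rightarrow> 'p) set)"
    and I: "directed_poset I leq"
    and copy: "\<And>i. i \<in> I \<Longrightarrow> has_copy (A i)"
    and \<psi>: "\<And>i j. (i, j) \<in> leq \<Longrightarrow> \<psi> i j \<in> ring_hom (A j) (A i)"
    and \<psi>_id: "\<And>i x. i \<in> I \<Longrightarrow> x \<in> carrier (A i) \<Longrightarrow> \<psi> i i x = x"
    and \<psi>_comp: "\<And>i j k x. (i, j) \<in> leq \<Longrightarrow> (j, k) \<in> leq \<Longrightarrow> x \<in> carrier (A k) \<Longrightarrow>
      \<psi> i j (\<psi> j k x) = \<psi> i k x"
    and p: "\<And>i. i \<in> I \<Longrightarrow> p i \<in> ring_hom S (A i)"
    and commute: "\<And>i j x. (i, j) \<in> leq \<Longrightarrow> x \<in> carrier S \<Longrightarrow> \<psi> i j (p j x) = p i x"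
    and inj: "\<And>x y. x \<in> carrier S \<Longrightarrow> y \<in> carrier S \<Longrightarrow> (\<And>i. i \<in> I \<Longrightarrow> p i x = p i y) \<Longrightarrow> x = y"
    and surj: "\<And>y. (\<And>i. i \<in> I \<Longrightarrow> y i \<in> carrier (A i)) \<Longrightarrow>
      (\<And>i j. (i, j) \<in> leq \<Longrightarrow> \<psi> i j (y j) = y i) \<Longrightarrow> \<exists>x\<in>carrier S. \<forall>i\<in>I. p i x = y i"
  shows "has_copy S"
proof -
  \<comment> \<open>Bundling the ring, the isomorphism and its inverse into one predicate allows the
    three to be chosen in turn, uniformly in \<open>i\<close>.\<close>
  define iso_pair where "iso_pair = (\<lambda>i F \<alpha> \<beta>. F \<in> K \<and> \<alpha> \<in> ring_iso F (A i) \<and> \<beta> \<in> ring_iso (A i) F \<and>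
      (\<forall>x\<in>carrier F. \<beta> (\<alpha> x) = x) \<and> (\<forall>y\<in>carrier (A i). \<alpha> (\<beta> y) = y))"
  have "\<forall>i\<in>I. \<exists>F \<alpha> \<beta>. iso_pair i F \<alpha> \<beta>"
    unfolding iso_pair_def by (intro ballI, rule has_copyE[OF copy]) blast+
  then obtain F where "\<forall>i\<in>I. \<exists>\<alpha> \<beta>. iso_pair i (F i) \<alpha> \<beta>"
    by (auto dest!: bchoice)
  then obtain \<alpha> where "\<forall>i\<in>I. \<exists>\<beta>. iso_pair i (F i) (\<alpha> i) \<beta>"
    by (auto dest!: bchoice)
  then obtain \<beta> where "\<forall>i\<in>I. iso_pair i (F i) (\<alpha> i) (\<beta> i)"
    by (auto dest!: bchoice)
  then have F: "\<And>i. i \<in> I \<Longrightarrow> F i \<in> K"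
    and \<alpha>: "\<And>i. i \<in> I \<Longrightarrow> \<alpha> i \<in> ring_iso (F i) (A i)"
    and \<beta>: "\<And>i. i \<in> I \<Longrightarrow> \<beta> i \<in> ring_iso (A i) (F i)"
    and \<beta>\<alpha>: "\<And>i x. i \<in> I \<Longrightarrow> x \<in> carrier (F i) \<Longrightarrow> \<beta> i (\<alpha> i x) = x"
    and \<alpha>\<beta>: "\<And>i y. i \<in> I \<Longrightarrow> y \<in> carrier (A i) \<Longrightarrow> \<alpha> i (\<beta> i y) = y"
    by (simp_all add: iso_pair_def)
  note \<alpha>m = ring_iso_memE[OF \<alpha>] note \<beta>m = ring_iso_memE[OF \<beta>]
  note pm = ring_hom_memE[OF p] note \<psi>m = ring_hom_memE[OF \<psi>]
  have leq: "i \<in> I" "j \<in> I" if "(i, j) \<in> leq" for i j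
    using I that by (auto simp: directed_poset_def dest: partial_order_onD)
  define \<phi> where "\<phi> = (\<lambda>i j x. \<beta> i (\<psi> i j (\<alpha> j x)))"
  let ?L = "inverse_limit_ring I leq F \<phi>"
  have sys: "inverse_system I leq F \<phi>"
    unfolding inverse_system_def
  proof (intro conjI ballI allI impI)
    show "directed_poset I leq" by (rule I)
    show "ring (F i)" if "i \<in> I" for i using F[OF that] by (rule rings)
    show "case ij of (i, j) \<Rightarrow> \<phi> i j \<in> ring_hom (F j) (F i)" if mem: "ij \<in> leq" for ij
    proof -
      obtain i j where ij: "ij = (i, j)" "(i, j) \<in> leq"
        using mem by (cases ij) auto
      have "\<phi> i j \<in> ring_hom (F j) (F i)"
        using leq[OF ij(2)] by (intro ring_hom_memI) (simp_all add: \<phi>_def \<alpha>m \<beta>m \<psi>m ij)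
      then show ?thesis using ij by simp
    qed
    show "\<phi> i i x = x" if "i \<in> I" "x \<in> carrier (F i)" for i x
      using that by (simp add: \<phi>_def \<psi>_id \<alpha>m \<beta>\<alpha>)
    show "\<phi> i j (\<phi> j k x) = \<phi> i k x"
      if "(i, j) \<in> leq" "(j, k) \<in> leq" "x \<in> carrier (F k)" for i j k x
      using that leq by (simp add: \<phi>_def \<psi>_comp \<alpha>m \<alpha>\<beta> \<psi>m)
  qed
  define e where "e = (\<lambda>x. \<lambda>i\<in>I. \<beta> i (p i x))"
  have e_carrier: "e x \<in> carrier ?L" if "x \<in> carrier S" for x
  proof -
    have "\<phi> i j (e x j) = e x i" if "(i, j) \<in> leq" for i j
      using leq[OF that] \<open>x \<in> carrier S\<close> that by (simp add: \<phi>_def e_def \<alpha>\<beta> pm commute)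
    moreover have "e x \<in> carrier (product_ring I F)"
      using that by (auto simp: product_ring_def e_def \<beta>m pm)
    ultimately show ?thesis
      by (auto simp: inverse_limit_ring_def)
  qed
  have iso: "e \<in> ring_iso S ?L"
  proof (rule ring_iso_memI)
    fix x assume "x \<in> carrier S"
    then show "e x \<in> carrier ?L" by (rule e_carrier)
  next
    fix x y assume xy: "x \<in> carrier S" "y \<in> carrier S"
    then show "e (x \<otimes>\<^bsub>S\<^esub> y) = e x \<otimes>\<^bsub>?L\<^esub> e y" "e (x \<oplus>\<^bsub>S\<^esub> y) = e x \<oplus>\<^bsub>?L\<^esub> e y"
      by (auto simp: e_def inverse_limit_ring_def product_ring_def \<beta>m pm intro!: restrict_ext)
  next
    show "e \<one>\<^bsub>S\<^esub> = \<one>\<^bsub>?L\<^esub>"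
      by (auto simp: e_def inverse_limit_ring_def product_ring_def \<beta>m pm intro!: restrict_ext)
  next
    show "bij_betw e (carrier S) (carrier ?L)"
    proof (rule bij_betw_imageI)
      show "inj_on e (carrier S)"
      proof (rule inj_onI)
        fix x y assume xy: "x \<in> carrier S" "y \<in> carrier S" "e x = e y"
        show "x = y"
        proof (rule inj[OF xy(1,2)])
          fix i assume i: "i \<in> I"
          then have "\<alpha> i (e x i) = \<alpha> i (e y i)" using xy by simp
          then show "p i x = p i y" using i xy by (simp add: e_def \<alpha>\<beta> pm)
        qed
      qed
      show "e ` carrier S = carrier ?L"
      proof (intro equalityI subsetI)
        fix z assume "z \<in> e ` carrier S"
        then show "z \<in> carrier ?L" using e_carrier by auto
      next
        fix z assume z: "z \<in> carrier ?L"
        then have zF: "z i \<in> carrier (F i)" if "i \<in> I" for i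
          using that by (auto simp: inverse_limit_ring_def product_ring_def)
        have z\<phi>: "\<phi> i j (z j) = z i" if "(i, j) \<in> leq" for i j
          using that z by (auto simp: inverse_limit_ring_def)
        have "\<exists>x\<in>carrier S. \<forall>i\<in>I. p i x = \<alpha> i (z i)"
        proof (rule surj)
          show "\<alpha> i (z i) \<in> carrier (A i)" if "i \<in> I" for i
            using that by (simp add: \<alpha>m zF)
          show "\<psi> i j (\<alpha> j (z j)) = \<alpha> i (z i)" if "(i, j) \<in> leq" for i j
          proof -
            have "\<alpha> i (\<phi> i j (z j)) = \<alpha> i (z i)" using z\<phi>[OF that] by simp
            then show ?thesis using that leq[OF that] by (simp add: \<phi>_def \<alpha>\<beta> \<psi>m \<alpha>m zF)
          qed
        qed
        then obtain x where x: "x \<in> carrier S" "\<And>i. i \<in> I \<Longrightarrow> p i x = \<alpha> i (z i)"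
          by blast
        have "z \<in> extensional I"
          using z by (auto simp: inverse_limit_ring_def product_ring_def PiE_def)
        then have "z = e x"
          by (rule extensionalityI) (simp_all add: e_def x \<beta>\<alpha> zF)
        then show "z \<in> e ` carrier S" using x by blast
      qed
    qed
  qed
  obtain S0 :: "('k \<Rightarrow> 'p) ring" where S0: "ring S0" "S0 \<simeq> S"
    using copies_nonempty[OF S] by (auto simp: copies_def)
  have "S0 \<simeq> ?L"
    using S0(2) iso by (auto simp: is_ring_iso_def dest: ring_iso_set_trans)
  then have "S0 \<in> copies ?L"
    using S0(1) by (simp add: copies_def)
  then have "S0 \<in> K"
    using inverse_limits sys F unfolding closed_under_inverse_limits_def by blast
  then show ?thesis
    using S0(2) by (auto simp: has_copy_def)
qed

end

section \<open>Incidence rings\<close>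

lemma preorder_onD:
  assumes "preorder_on \<Lambda> r"
  shows "s \<in> \<Lambda> \<Longrightarrow> (s, s) \<in> r" "(s, t) \<in> r \<Longrightarrow> (t, u) \<in> r \<Longrightarrow> (s, u) \<in> r"
    "(s, t) \<in> r \<Longrightarrow> s \<in> \<Lambda>" "(s, t) \<in> r \<Longrightarrow> t \<in> \<Lambda>"
  using assms by (auto simp: preorder_on_def refl_on_def dest: transD)

lemma proset_interval_eq_empty:
  assumes "preorder_on \<Lambda> r" "(s, t) \<notin> r" shows "proset_interval \<Lambda> r s t = {}"
  using assms preorder_onD(2)[OF assms(1)] by (auto simp: proset_interval_def)

lemma finite_proset_interval:
  assumes "preorder_on \<Lambda> r" "locally_finite \<Lambda> r"
  shows "finite (proset_interval \<Lambda> r s t)"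
  using assms proset_interval_eq_empty[OF assms(1), of s t]
  by (cases "(s, t) \<in> r") (auto simp: locally_finite_def)

lemma locally_finite_if_finite: "finite \<Lambda> \<Longrightarrow> locally_finite \<Lambda> r"
  by (auto simp: locally_finite_def proset_interval_def)

lemma incidence_ring_carrier_iff:
  "a \<in> carrier (incidence_ring \<Lambda> r P) \<longleftrightarrow>
    a \<in> \<Lambda> \<times> \<Lambda> \<rightarrow>\<^sub>E carrier P \<and> (\<forall>s\<in>\<Lambda>. \<forall>t\<in>\<Lambda>. (s, t) \<notin> r \<longrightarrow> a (s, t) = \<zero>\<^bsub>P\<^esub>)"
  by (auto simp: incidence_ring_def)

lemma incidence_ring_closed:
  "a \<in> carrier (incidence_ring \<Lambda> r P) \<Longrightarrow> s \<in> \<Lambda> \<Longrightarrow> t \<in> \<Lambda> \<Longrightarrow> a (s, t) \<in> carrier P"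
  by (auto simp: incidence_ring_carrier_iff)

lemma incidence_ring_eq_zero:
  "a \<in> carrier (incidence_ring \<Lambda> r P) \<Longrightarrow> s \<in> \<Lambda> \<Longrightarrow> t \<in> \<Lambda> \<Longrightarrow> (s, t) \<notin> r \<Longrightarrow>
    a (s, t) = \<zero>\<^bsub>P\<^esub>"
  by (auto simp: incidence_ring_carrier_iff)

lemma incidence_ring_ext:
  assumes "a \<in> extensional (\<Lambda> \<times> \<Lambda>)" "b \<in> extensional (\<Lambda> \<times> \<Lambda>)"
    and "\<And>s t. s \<in> \<Lambda> \<Longrightarrow> t \<in> \<Lambda> \<Longrightarrow> a (s, t) = b (s, t)"
  shows "a = b"
  using assms by (intro extensionalityI[of _ "\<Lambda> \<times> \<Lambda>"]) auto

lemma incidence_ring_extensional: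
  "a \<in> carrier (incidence_ring \<Lambda> r P) \<Longrightarrow> a \<in> extensional (\<Lambda> \<times> \<Lambda>)"
  "a \<otimes>\<^bsub>incidence_ring \<Lambda> r P\<^esub> b \<in> extensional (\<Lambda> \<times> \<Lambda>)"
  "a \<oplus>\<^bsub>incidence_ring \<Lambda> r P\<^esub> b \<in> extensional (\<Lambda> \<times> \<Lambda>)"
  "\<one>\<^bsub>incidence_ring \<Lambda> r P\<^esub> \<in> extensional (\<Lambda> \<times> \<Lambda>)"
  "\<zero>\<^bsub>incidence_ring \<Lambda> r P\<^esub> \<in> extensional (\<Lambda> \<times> \<Lambda>)"
  by (auto simp: incidence_ring_def extensional_def)

lemma incidence_ring_apply:
  assumes "s \<in> \<Lambda>" "t \<in> \<Lambda>"
  shows "(a \<otimes>\<^bsub>incidence_ring \<Lambda> r P\<^esub> b) (s, t) =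
      (\<Oplus>\<^bsub>P\<^esub> u \<in> proset_interval \<Lambda> r s t. a (s, u) \<otimes>\<^bsub>P\<^esub> b (u, t))"
    and "(a \<oplus>\<^bsub>incidence_ring \<Lambda> r P\<^esub> b) (s, t) = a (s, t) \<oplus>\<^bsub>P\<^esub> b (s, t)"
    and "\<one>\<^bsub>incidence_ring \<Lambda> r P\<^esub> (s, t) = (if s = t then \<one>\<^bsub>P\<^esub> else \<zero>\<^bsub>P\<^esub>)"
    and "\<zero>\<^bsub>incidence_ring \<Lambda> r P\<^esub> (s, t) = \<zero>\<^bsub>P\<^esub>"
  using assms by (simp_all add: incidence_ring_def)

section \<open>The ring axioms for incidence rings\<close>

lemma (in abelian_monoid) finsum_comm:
  assumes "finite A" "finite B" "\<And>x y. x \<in> A \<Longrightarrow> y \<in> B \<Longrightarrow> f x y \<in> carrier G"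
  shows "(\<Oplus>x\<in>A. \<Oplus>y\<in>B. f x y) = (\<Oplus>y\<in>B. \<Oplus>x\<in>A. f x y)"
  using assms(1,3)
proof (induction A)
  case empty
  then show ?case by (simp add: finsum_zero)
next
  case (insert x A)
  then have "(\<Oplus>x\<in>insert x A. \<Oplus>y\<in>B. f x y) = (\<Oplus>y\<in>B. f x y) \<oplus> (\<Oplus>y\<in>B. \<Oplus>x\<in>A. f x y)"
    by (subst finsum_insert) (auto intro!: finsum_closed)
  also have "\<dots> = (\<Oplus>y\<in>B. f x y \<oplus> (\<Oplus>x\<in>A. f x y))"
    using insert.prems by (subst finsum_addf) (auto intro!: finsum_closed)
  also have "\<dots> = (\<Oplus>y\<in>B. \<Oplus>x\<in>insert x A. f x y)"
    using insert by (intro finsum_cong') (auto intro!: finsum_closed simp: finsum_insert Pi_def)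
  finally show ?case .
qed

text \<open>For an index outside the interval one of the two factors is an entry off
  \<open>r\<close>, hence zero. Products taken over different intervals can therefore be summed over
  one common finite index set.\<close>

lemma (in ring) incidence_ring_mult_superset:
  assumes a: "a \<in> carrier (incidence_ring \<Lambda> r R)" and b: "b \<in> carrier (incidence_ring \<Lambda> r R)"
    and st: "s \<in> \<Lambda>" "t \<in> \<Lambda>" and N: "finite N" "N \<subseteq> \<Lambda>" "proset_interval \<Lambda> r s t \<subseteq> N"
  shows "(a \<otimes>\<^bsub>incidence_ring \<Lambda> r R\<^esub> b) (s, t) = (\<Oplus>u\<in>N. a (s, u) \<otimes> b (u, t))"
proof -
  have ab: "a (s, u) \<in> carrier R" "b (u, t) \<in> carrier R" if "u \<in> N" for u
    using that N st incidence_ring_closed[OF a] incidence_ring_closed[OF b] by auto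
  have "a (s, u) \<otimes> b (u, t) = \<zero>" if u: "u \<in> N - proset_interval \<Lambda> r s t" for u
  proof -
    have "u \<in> \<Lambda>" "(s, u) \<notin> r \<or> (u, t) \<notin> r"
      using u N by (auto simp: proset_interval_def)
    then have "a (s, u) = \<zero> \<or> b (u, t) = \<zero>"
      using st incidence_ring_eq_zero[OF a] incidence_ring_eq_zero[OF b] by metis
    then show ?thesis using ab u by auto
  qed
  then show ?thesis
    unfolding incidence_ring_apply(1)[OF st] using N ab
    by (intro add.finprod_mono_neutral_cong_left) auto
qed

text \<open>All laws are checked entry by entry. Local finiteness makes the defining sums finite;
  transitivity makes intervals off \<open>r\<close> empty, so products are again supported on
  \<open>r\<close>; reflexivity puts the identity matrix into the carrier.\<close>

lemma ring_incidence_ring: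
  assumes P: "ring P" and r: "preorder_on \<Lambda> r" and lf: "locally_finite \<Lambda> r"
  shows "ring (incidence_ring \<Lambda> r P)" (is "ring ?M")
proof -
  interpret P: ring P by (rule P)
  note refl = preorder_onD(1)[OF r] and trans = preorder_onD(2)[OF r]
  note fin = finite_proset_interval[OF r lf]
  note cl = incidence_ring_closed[where \<Lambda> = \<Lambda> and r = r and P = P]
  note zero = incidence_ring_eq_zero[where \<Lambda> = \<Lambda> and r = r and P = P]
  note ap = incidence_ring_apply[where \<Lambda> = \<Lambda> and r = r and P = P]
  note exts = incidence_ring_extensional[where \<Lambda> = \<Lambda> and r = r and P = P]
  have int: "u \<in> \<Lambda>" if "u \<in> proset_interval \<Lambda> r s t" for s t u
    using that by (simp add: proset_interval_def)
  have add_cl: "a \<oplus>\<^bsub>?M\<^esub> b \<in> carrier ?M" if "a \<in> carrier ?M" "b \<in> carrier ?M" for a b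
    using that exts(3)[of a b] by (auto simp: incidence_ring_carrier_iff[of "a \<oplus>\<^bsub>?M\<^esub> b"] PiE_iff ap cl zero)
  have zero_cl: "\<zero>\<^bsub>?M\<^esub> \<in> carrier ?M"
    using exts(5) by (auto simp: incidence_ring_carrier_iff PiE_iff ap)
  have one_cl: "\<one>\<^bsub>?M\<^esub> \<in> carrier ?M"
    using exts(4) by (auto simp: incidence_ring_carrier_iff PiE_iff ap refl)
  have mult_cl: "a \<otimes>\<^bsub>?M\<^esub> b \<in> carrier ?M" if "a \<in> carrier ?M" "b \<in> carrier ?M" for a b
    using that exts(2)[of a b] proset_interval_eq_empty[OF r]
    by (auto simp: incidence_ring_carrier_iff[of "a \<otimes>\<^bsub>?M\<^esub> b"] PiE_iff ap cl int
        intro!: P.finsum_closed)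
  show ?thesis
  proof (rule ringI)
    show "abelian_group ?M"
    proof (rule abelian_groupI)
      fix a b c assume abc: "a \<in> carrier ?M" "b \<in> carrier ?M" "c \<in> carrier ?M"
      show "(a \<oplus>\<^bsub>?M\<^esub> b) \<oplus>\<^bsub>?M\<^esub> c = a \<oplus>\<^bsub>?M\<^esub> (b \<oplus>\<^bsub>?M\<^esub> c)"
        by (rule incidence_ring_ext[of _ \<Lambda>]) (simp_all add: exts ap cl abc P.a_assoc)
    next
      fix a b assume ab: "a \<in> carrier ?M" "b \<in> carrier ?M"
      show "a \<oplus>\<^bsub>?M\<^esub> b = b \<oplus>\<^bsub>?M\<^esub> a"
        by (rule incidence_ring_ext[of _ \<Lambda>]) (simp_all add: exts ap cl ab P.a_comm)
    next
      fix a assume a: "a \<in> carrier ?M"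
      show "\<zero>\<^bsub>?M\<^esub> \<oplus>\<^bsub>?M\<^esub> a = a"
        by (rule incidence_ring_ext[of _ \<Lambda>]) (simp_all add: exts ap cl a)
      let ?b = "\<lambda>x\<in>\<Lambda> \<times> \<Lambda>. \<ominus>\<^bsub>P\<^esub> a x"
      have "?b \<in> carrier ?M"
        using a by (auto simp: incidence_ring_carrier_iff[of ?b] cl zero)
      moreover have "?b \<oplus>\<^bsub>?M\<^esub> a = \<zero>\<^bsub>?M\<^esub>"
        by (rule incidence_ring_ext[of _ \<Lambda>]) (simp_all add: exts ap cl a P.l_neg)
      ultimately show "\<exists>b\<in>carrier ?M. b \<oplus>\<^bsub>?M\<^esub> a = \<zero>\<^bsub>?M\<^esub>" by blast
    qed (fact add_cl zero_cl)+
    show "monoid ?M"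
    proof (rule monoidI)
      fix a b c assume abc: "a \<in> carrier ?M" "b \<in> carrier ?M" "c \<in> carrier ?M"
      show "(a \<otimes>\<^bsub>?M\<^esub> b) \<otimes>\<^bsub>?M\<^esub> c = a \<otimes>\<^bsub>?M\<^esub> (b \<otimes>\<^bsub>?M\<^esub> c)"
      proof (rule incidence_ring_ext[of _ \<Lambda>])
        fix s t assume st: "s \<in> \<Lambda>" "t \<in> \<Lambda>"
        \<comment> \<open>All the sums run over the one interval from \<open>s\<close> to \<open>t\<close>, where they can be exchanged.\<close>
        let ?N = "proset_interval \<Lambda> r s t"
        have sub: "proset_interval \<Lambda> r s u \<subseteq> ?N" "proset_interval \<Lambda> r u t \<subseteq> ?N"
          if "u \<in> ?N" for u
          using that trans by (auto simp: proset_interval_def)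
        have N: "?N \<subseteq> \<Lambda>" using int by blast
        have "((a \<otimes>\<^bsub>?M\<^esub> b) \<otimes>\<^bsub>?M\<^esub> c) (s, t) = (\<Oplus>\<^bsub>P\<^esub>u\<in>?N. (a \<otimes>\<^bsub>?M\<^esub> b) (s, u) \<otimes>\<^bsub>P\<^esub> c (u, t))"
          using st by (simp add: ap)
        also have "\<dots> = (\<Oplus>\<^bsub>P\<^esub>u\<in>?N. \<Oplus>\<^bsub>P\<^esub>v\<in>?N. a (s, v) \<otimes>\<^bsub>P\<^esub> b (v, u) \<otimes>\<^bsub>P\<^esub> c (u, t))"
        proof (rule P.finsum_cong', goal_cases)
          case (3 u)
          then show ?case
            using P.incidence_ring_mult_superset[OF abc(1,2) st(1) int[OF 3] fin N sub(1)[OF 3]]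
            by (auto simp: P.finsum_ldistr fin cl abc st int)
        qed (auto intro!: P.finsum_closed simp: cl abc st int)
        also have "\<dots> = (\<Oplus>\<^bsub>P\<^esub>v\<in>?N. \<Oplus>\<^bsub>P\<^esub>u\<in>?N. a (s, v) \<otimes>\<^bsub>P\<^esub> b (v, u) \<otimes>\<^bsub>P\<^esub> c (u, t))"
          by (rule P.finsum_comm) (auto simp: fin cl abc st int)
        also have "\<dots> = (\<Oplus>\<^bsub>P\<^esub>v\<in>?N. a (s, v) \<otimes>\<^bsub>P\<^esub> (b \<otimes>\<^bsub>?M\<^esub> c) (v, t))"
        proof (rule P.finsum_cong', goal_cases)
          case (3 v)
          then have "(b \<otimes>\<^bsub>?M\<^esub> c) (v, t) = (\<Oplus>\<^bsub>P\<^esub>u\<in>?N. b (v, u) \<otimes>\<^bsub>P\<^esub> c (u, t))"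
            using P.incidence_ring_mult_superset[OF abc(2,3) int[OF 3] st(2) fin N sub(2)[OF 3]]
            by simp
          with 3 show ?case
            by (auto simp: P.finsum_rdistr P.m_assoc fin cl abc st int intro!: P.finsum_cong')
        qed (auto intro!: P.finsum_closed simp: cl abc mult_cl st int)
        also have "\<dots> = (a \<otimes>\<^bsub>?M\<^esub> (b \<otimes>\<^bsub>?M\<^esub> c)) (s, t)"
          using st by (simp add: ap)
        finally show "((a \<otimes>\<^bsub>?M\<^esub> b) \<otimes>\<^bsub>?M\<^esub> c) (s, t) = (a \<otimes>\<^bsub>?M\<^esub> (b \<otimes>\<^bsub>?M\<^esub> c)) (s, t)" .
      qed (simp_all add: exts)
    next
      fix a assume a: "a \<in> carrier ?M"
      show "\<one>\<^bsub>?M\<^esub> \<otimes>\<^bsub>?M\<^esub> a = a"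
      proof (rule incidence_ring_ext[of _ \<Lambda>])
        fix s t assume st: "s \<in> \<Lambda>" "t \<in> \<Lambda>"
        \<comment> \<open>The interval is empty when \<open>(s, t) \<notin> r\<close>. Inserting
          \<open>s\<close> guarantees that the diagonal index is present, so both cases collapse to
          the single term \<open>a (s, t)\<close>.\<close>
        have "(\<one>\<^bsub>?M\<^esub> \<otimes>\<^bsub>?M\<^esub> a) (s, t) =
            (\<Oplus>\<^bsub>P\<^esub>u\<in>insert s (proset_interval \<Lambda> r s t). \<one>\<^bsub>?M\<^esub> (s, u) \<otimes>\<^bsub>P\<^esub> a (u, t))"
          using st fin int by (intro P.incidence_ring_mult_superset one_cl a) auto
        also have "\<dots> = (\<Oplus>\<^bsub>P\<^esub>u\<in>insert s (proset_interval \<Lambda> r s t). if s = u then a (u, t) else \<zero>\<^bsub>P\<^esub>)"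
          using st int by (intro P.finsum_cong') (auto simp: ap cl a)
        also have "\<dots> = a (s, t)"
          using st int fin by (intro P.finsum_singleton) (auto simp: cl a)
        finally show "(\<one>\<^bsub>?M\<^esub> \<otimes>\<^bsub>?M\<^esub> a) (s, t) = a (s, t)" .
      qed (simp_all add: exts a)
      show "a \<otimes>\<^bsub>?M\<^esub> \<one>\<^bsub>?M\<^esub> = a"
      proof (rule incidence_ring_ext[of _ \<Lambda>])
        fix s t assume st: "s \<in> \<Lambda>" "t \<in> \<Lambda>"
        have "(a \<otimes>\<^bsub>?M\<^esub> \<one>\<^bsub>?M\<^esub>) (s, t) =
            (\<Oplus>\<^bsub>P\<^esub>u\<in>insert t (proset_interval \<Lambda> r s t). a (s, u) \<otimes>\<^bsub>P\<^esub> \<one>\<^bsub>?M\<^esub> (u, t))"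
          using st fin int by (intro P.incidence_ring_mult_superset one_cl a) auto
        also have "\<dots> = (\<Oplus>\<^bsub>P\<^esub>u\<in>insert t (proset_interval \<Lambda> r s t). if t = u then a (s, u) else \<zero>\<^bsub>P\<^esub>)"
          using st int by (intro P.finsum_cong') (auto simp: ap cl a)
        also have "\<dots> = a (s, t)"
          using st int fin by (intro P.finsum_singleton) (auto simp: cl a)
        finally show "(a \<otimes>\<^bsub>?M\<^esub> \<one>\<^bsub>?M\<^esub>) (s, t) = a (s, t)" .
      qed (simp_all add: exts a)
    qed (fact mult_cl one_cl)+
    fix a b c assume abc: "a \<in> carrier ?M" "b \<in> carrier ?M" "c \<in> carrier ?M"
    show "(a \<oplus>\<^bsub>?M\<^esub> b) \<otimes>\<^bsub>?M\<^esub> c = a \<otimes>\<^bsub>?M\<^esub> c \<oplus>\<^bsub>?M\<^esub> b \<otimes>\<^bsub>?M\<^esub> c"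
    proof (rule incidence_ring_ext[of _ \<Lambda>])
      fix s t assume st: "s \<in> \<Lambda>" "t \<in> \<Lambda>"
      have "((a \<oplus>\<^bsub>?M\<^esub> b) \<otimes>\<^bsub>?M\<^esub> c) (s, t) =
          (\<Oplus>\<^bsub>P\<^esub>u\<in>proset_interval \<Lambda> r s t. a (s, u) \<otimes>\<^bsub>P\<^esub> c (u, t) \<oplus>\<^bsub>P\<^esub> b (s, u) \<otimes>\<^bsub>P\<^esub> c (u, t))"
        unfolding ap(1)[OF st] using st
        by (intro P.finsum_cong') (auto dest: int simp: ap cl abc P.l_distr)
      also have "\<dots> = (a \<otimes>\<^bsub>?M\<^esub> c \<oplus>\<^bsub>?M\<^esub> b \<otimes>\<^bsub>?M\<^esub> c) (s, t)"
        using st by (subst P.finsum_addf) (auto dest: int simp: ap cl abc)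
      finally show "((a \<oplus>\<^bsub>?M\<^esub> b) \<otimes>\<^bsub>?M\<^esub> c) (s, t) = (a \<otimes>\<^bsub>?M\<^esub> c \<oplus>\<^bsub>?M\<^esub> b \<otimes>\<^bsub>?M\<^esub> c) (s, t)" .
    qed (simp_all add: exts)
    show "c \<otimes>\<^bsub>?M\<^esub> (a \<oplus>\<^bsub>?M\<^esub> b) = c \<otimes>\<^bsub>?M\<^esub> a \<oplus>\<^bsub>?M\<^esub> c \<otimes>\<^bsub>?M\<^esub> b"
    proof (rule incidence_ring_ext[of _ \<Lambda>])
      fix s t assume st: "s \<in> \<Lambda>" "t \<in> \<Lambda>"
      have "(c \<otimes>\<^bsub>?M\<^esub> (a \<oplus>\<^bsub>?M\<^esub> b)) (s, t) =
          (\<Oplus>\<^bsub>P\<^esub>u\<in>proset_interval \<Lambda> r s t. c (s, u) \<otimes>\<^bsub>P\<^esub> a (u, t) \<oplus>\<^bsub>P\<^esub> c (s, u) \<otimes>\<^bsub>P\<^esub> b (u, t))"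
        unfolding ap(1)[OF st] using st
        by (intro P.finsum_cong') (auto dest: int simp: ap cl abc P.r_distr)
      also have "\<dots> = (c \<otimes>\<^bsub>?M\<^esub> a \<oplus>\<^bsub>?M\<^esub> c \<otimes>\<^bsub>?M\<^esub> b) (s, t)"
        using st by (subst P.finsum_addf) (auto dest: int simp: ap cl abc)
      finally show "(c \<otimes>\<^bsub>?M\<^esub> (a \<oplus>\<^bsub>?M\<^esub> b)) (s, t) = (c \<otimes>\<^bsub>?M\<^esub> a \<oplus>\<^bsub>?M\<^esub> c \<otimes>\<^bsub>?M\<^esub> b) (s, t)" .
    qed (simp_all add: exts)
  qed
qed

section \<open>Reindexing incidence rings\<close>

definition incidence_pull :: "('c \<Rightarrow> 'l) \<Rightarrow> 'c set \<Rightarrow> ('l \<times> 'l \<Rightarrow> 'p) \<Rightarrow> 'c \<times> 'c \<Rightarrow> 'p" where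
  "incidence_pull h C a = (\<lambda>(s, t)\<in>C \<times> C. a (h s, h t))"

lemma incidence_pull_apply:
  "s \<in> C \<Longrightarrow> t \<in> C \<Longrightarrow> incidence_pull h C a (s, t) = a (h s, h t)"
  by (simp add: incidence_pull_def)

lemma incidence_pull_extensional: "incidence_pull h C a \<in> extensional (C \<times> C)"
  by (simp add: incidence_pull_def)

text \<open>
  Covers restriction to a convex subset, relabelling along an isomorphism, and the inclusion
  coming from a coarser relation on the same set.
\<close>

lemma incidence_pull_hom:
  assumes P: "ring P" and r: "preorder_on \<Lambda> r" "locally_finite \<Lambda> r"
    and q: "preorder_on C q" "locally_finite C q"
    and h: "inj_on h C" "h ` C \<subseteq> \<Lambda>"
    and reflect: "\<And>s t. s \<in> C \<Longrightarrow> t \<in> C \<Longrightarrow> (h s, h t) \<in> r \<Longrightarrow> (s, t) \<in> q"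
    and convex: "\<And>s t u. s \<in> C \<Longrightarrow> t \<in> C \<Longrightarrow> (h s, u) \<in> r \<Longrightarrow> (u, h t) \<in> r \<Longrightarrow> u \<in> h ` C"
  shows "incidence_pull h C \<in> ring_hom (incidence_ring \<Lambda> r P) (incidence_ring C q P)"
    (is "_ \<in> ring_hom ?M ?N")
proof -
  interpret P: ring P by (rule P)
  have hL: "h s \<in> \<Lambda>" if "s \<in> C" for s using h that by auto
  note ap = incidence_ring_apply incidence_pull_apply
  note exts = incidence_ring_extensional incidence_pull_extensional
  have carrier: "incidence_pull h C a \<in> carrier ?N" if "a \<in> carrier ?M" for a
    using that exts(6)[of h C a] reflect
    by (auto simp: incidence_ring_carrier_iff[of "incidence_pull h C a"] PiE_iff ap hL
        intro: incidence_ring_closed incidence_ring_eq_zero)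
  show ?thesis
  proof (rule ring_hom_memI)
    fix a b assume ab: "a \<in> carrier ?M" "b \<in> carrier ?M"
    show "incidence_pull h C (a \<oplus>\<^bsub>?M\<^esub> b) = incidence_pull h C a \<oplus>\<^bsub>?N\<^esub> incidence_pull h C b"
      by (rule incidence_ring_ext[of _ C]) (simp_all add: ap exts hL)
    show "incidence_pull h C (a \<otimes>\<^bsub>?M\<^esub> b) = incidence_pull h C a \<otimes>\<^bsub>?N\<^esub> incidence_pull h C b"
    proof (rule incidence_ring_ext[of _ C])
      fix s t assume st: "s \<in> C" "t \<in> C"
      let ?I = "proset_interval C q s t"
      have I: "?I \<subseteq> C" by (auto simp: proset_interval_def)
      have "(a \<otimes>\<^bsub>?M\<^esub> b) (h s, h t) = (\<Oplus>\<^bsub>P\<^esub>v\<in>h ` ?I. a (h s, v) \<otimes>\<^bsub>P\<^esub> b (v, h t))"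
      proof (rule P.incidence_ring_mult_superset)
        \<comment> \<open>Convexity puts an intermediate index into the image of \<open>h\<close>,
          and reflection of the order puts its preimage into the interval for \<open>q\<close>. That
          interval may be larger, as \<open>q\<close> may be coarser than \<open>r\<close>; the
          additional summands vanish.\<close>
        show "proset_interval \<Lambda> r (h s) (h t) \<subseteq> h ` ?I"
          using st reflect convex[OF st] by (fastforce simp: proset_interval_def)
      qed (use I ab st hL finite_proset_interval[OF q] in auto)
      also have "\<dots> = (\<Oplus>\<^bsub>P\<^esub>u\<in>?I. a (h s, h u) \<otimes>\<^bsub>P\<^esub> b (h u, h t))"
        using I st hL inj_on_subset[OF h(1) I]
        by (intro P.finsum_reindex) (auto intro!: P.m_closed incidence_ring_closed[OF ab(1)] incidence_ring_closed[OF ab(2)])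
      also have "\<dots> = (\<Oplus>\<^bsub>P\<^esub>u\<in>?I. incidence_pull h C a (s, u) \<otimes>\<^bsub>P\<^esub> incidence_pull h C b (u, t))"
        using I st hL
        by (intro P.finsum_cong') (auto simp: ap subset_eq intro!: P.m_closed incidence_ring_closed[OF ab(1)] incidence_ring_closed[OF ab(2)])
      finally show "incidence_pull h C (a \<otimes>\<^bsub>?M\<^esub> b) (s, t) =
          (incidence_pull h C a \<otimes>\<^bsub>?N\<^esub> incidence_pull h C b) (s, t)"
        using st by (simp add: ap)
    qed (simp_all add: exts)
    show "incidence_pull h C a \<in> carrier ?N"
      using ab by (intro carrier)
  next
    show "incidence_pull h C \<one>\<^bsub>?M\<^esub> = \<one>\<^bsub>?N\<^esub>"
      using h(1) by (intro incidence_ring_ext[of _ C]) (auto simp: ap exts hL inj_on_eq_iff)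
  qed
qed

lemma incidence_pull_id:
  assumes "a \<in> carrier (incidence_ring C q P)"
  shows "incidence_pull (\<lambda>x. x) C a = a"
  using assms by (intro incidence_ring_ext[of _ C])
    (simp_all add: incidence_ring_extensional(1) incidence_pull_extensional incidence_pull_apply)

lemma incidence_pull_restrict:
  assumes "C \<subseteq> D"
  shows "incidence_pull (\<lambda>x. x) C (incidence_pull (\<lambda>x. x) D a) = incidence_pull (\<lambda>x. x) C a"
  using assms by (intro incidence_ring_ext[of _ C])
    (auto simp: incidence_pull_extensional incidence_pull_apply subset_eq)

text \<open>Reindexing along \<open>h\<close> and along its inverse are mutually inverse
  homomorphisms; convexity of the image is automatic because each map is onto.\<close>

lemma incidence_ring_iso:
  assumes P: "ring P" and r: "preorder_on \<Lambda> r" "locally_finite \<Lambda> r"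
    and q: "preorder_on C q" "locally_finite C q"
    and h: "bij_betw h C \<Lambda>"
    and iff: "\<And>s t. s \<in> C \<Longrightarrow> t \<in> C \<Longrightarrow> (h s, h t) \<in> r \<longleftrightarrow> (s, t) \<in> q"
  shows "incidence_ring \<Lambda> r P \<simeq> incidence_ring C q P" (is "?M \<simeq> ?N")
proof -
  have inj: "inj_on h C" and img: "h ` C = \<Lambda>"
    using h by (auto simp: bij_betw_def)
  let ?g = "inv_into C h"
  have g: "?g s \<in> C" "h (?g s) = s" if "s \<in> \<Lambda>" for s
    using that img by (auto simp: inv_into_into f_inv_into_f)
  have gh: "?g (h s) = s" "h s \<in> \<Lambda>" if "s \<in> C" for s
    using that inj img by auto
  have hom: "incidence_pull h C \<in> ring_hom ?M ?N"
    using preorder_onD(3)[OF r(1)] preorder_onD(4)[OF r(1)] img inj iff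
    by (intro incidence_pull_hom P r q) auto
  have "incidence_pull ?g \<Lambda> \<in> ring_hom ?N ?M"
  proof (intro incidence_pull_hom P r q)
    show "(s, t) \<in> r" if "s \<in> \<Lambda>" "t \<in> \<Lambda>" "(?g s, ?g t) \<in> q" for s t
      using that g iff[of "?g s" "?g t"] by simp
    show "u \<in> ?g ` \<Lambda>" if "(?g s, u) \<in> q" for s u
      using preorder_onD(4)[OF q(1) that] gh by (metis image_eqI)
  qed (auto simp: g inj_on_inv_into img)
  note hom' = ring_hom_memE(1)[OF this] ring_hom_memE(1)[OF hom]
  have "bij_betw (incidence_pull h C) (carrier ?M) (carrier ?N)"
  proof (rule bij_betw_byWitness[where f' = "incidence_pull ?g \<Lambda>"])
    show "\<forall>a\<in>carrier ?M. incidence_pull ?g \<Lambda> (incidence_pull h C a) = a"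
      by (auto intro!: incidence_ring_ext[of _ \<Lambda>]
          simp: incidence_pull_extensional incidence_ring_extensional incidence_pull_apply g)
    show "\<forall>a\<in>carrier ?N. incidence_pull h C (incidence_pull ?g \<Lambda> a) = a"
      by (auto intro!: incidence_ring_ext[of _ C]
          simp: incidence_pull_extensional incidence_ring_extensional incidence_pull_apply gh)
  qed (use hom' in auto)
  then show ?thesis
    using hom by (auto simp: is_ring_iso_def ring_iso_def)
qed

section \<open>Cardinality bounds\<close>

lemma infinite_pairing:
  assumes "infinite (UNIV :: 'k set)"
  obtains p :: "'k \<times> 'k \<Rightarrow> 'k" where "inj p"
proof -
  have "(UNIV :: 'k set) \<times> (UNIV :: 'k set) \<approx> (UNIV :: 'k set)"
    unfolding eqpoll_iff_card_of_ordIso using card_of_Times_same_infinite[OF assms] .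
  then show thesis
    using that by (auto simp: eqpoll_def bij_betw_def)
qed

text \<open>A finite set is listed in some order, and the list is compressed to one element by
  iterating an injection from pairs to elements.\<close>

lemma Fpow_lepoll_infinite:
  assumes inf: "infinite (UNIV :: 'k set)"
  shows "Fpow (UNIV :: 'k set) \<lesssim> (UNIV :: 'k set)"
proof -
  obtain p :: "'k \<times> 'k \<Rightarrow> 'k" where p: "inj p"
    using infinite_pairing[OF inf] .
  obtain num :: "nat \<Rightarrow> 'k" where num: "inj num"
    using inf by (auto simp: infinite_iff_countable_subset)
  define fold_p where "fold_p = rec_list (num 0) (\<lambda>x _ y. p (x, y))"
  have fold_p: "xs = ys" if "length xs = length ys" "fold_p xs = fold_p ys" for xs ys
    using that by (induction rule: list_induct2) (auto simp: fold_p_def inj_eq[OF p])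
  \<comment> \<open>The length must be recorded: the end value \<open>num 0\<close> may itself be a
    value of \<open>p\<close>, so \<open>fold_p\<close> is known to be injective only among lists of
    equal length.\<close>
  define code where "code = (\<lambda>xs. p (num (length xs), fold_p xs))"
  have code: "xs = ys" if "code xs = code ys" for xs ys
    using that by (auto simp: code_def inj_eq[OF p] inj_eq[OF num] intro: fold_p)
  define enum where "enum = (\<lambda>A :: 'k set. SOME xs. set xs = A)"
  have enum: "set (enum A) = A" if "finite A" for A
    unfolding enum_def using someI_ex[OF finite_list[OF that]] .
  have "inj_on (\<lambda>A. code (enum A)) (Fpow UNIV)"
    by (rule inj_onI) (metis (mono_tags, lifting) Fpow_def code enum mem_Collect_eq)
  then show ?thesis
    by (auto simp: lepoll_def)
qed

text \<open>A matrix is a function on \<Lambda> \<times> \<Lambda>, and this index set injects into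
  \<open>'k\<close> by pairing. Off the image of that injection the coded function takes irrelevant
  values, since matrices are recovered from the image alone.\<close>

lemma incidence_ring_carrier_lepoll:
  fixes P :: "('p, 'm) ring_scheme"
  assumes inf: "infinite (UNIV :: 'k set)" and le: "\<Lambda> \<lesssim> (UNIV :: 'k set)"
  shows "carrier (incidence_ring \<Lambda> r P) \<lesssim> (UNIV :: ('k \<Rightarrow> 'p) set)"
proof -
  obtain p :: "'k \<times> 'k \<Rightarrow> 'k" where p: "inj p"
    using infinite_pairing[OF inf] .
  obtain e :: "_ \<Rightarrow> 'k" where e: "inj_on e \<Lambda>"
    using le by (auto simp: lepoll_def)
  define h where "h = (\<lambda>(s, t). p (e s, e t))"
  have h: "inj_on h (\<Lambda> \<times> \<Lambda>)"
    by (rule inj_onI) (auto simp: h_def inj_eq[OF p] dest: inj_onD[OF e])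
  define code where "code = (\<lambda>(a :: _ \<Rightarrow> 'p) k. a (inv_into (\<Lambda> \<times> \<Lambda>) h k))"
  have "inj_on code (carrier (incidence_ring \<Lambda> r P))"
  proof (rule inj_onI)
    fix a b
    assume ab: "a \<in> carrier (incidence_ring \<Lambda> r P)" "b \<in> carrier (incidence_ring \<Lambda> r P)"
      and eq: "code a = code b"
    show "a = b"
    proof (rule incidence_ring_ext[of _ \<Lambda>])
      fix s t assume "s \<in> \<Lambda>" "t \<in> \<Lambda>"
      then show "a (s, t) = b (s, t)"
        using fun_cong[OF eq, of "h (s, t)"] h by (simp add: code_def)
    qed (use ab incidence_ring_extensional(1) in auto)
  qed
  then show ?thesis
    by (auto simp: lepoll_def)
qed

section \<open>Generating incidence rings\<close>

lemma preorder_on_arrow_rel: "preorder_on (arrow_carrier m n) (arrow_rel m n)"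
  by (auto simp: preorder_on_def refl_on_def trans_def arrow_carrier_def arrow_rel_def)

text \<open>One set gives a two-block preorder, the empty family gives the full relation, and adding
  a set to the family intersects with one more two-block preorder; this is what the induction in
  \<open>has_copy_finite\<close> runs on.\<close>

lemma preorder_on_respecting:
  "preorder_on C {(s, t) \<in> C \<times> C. \<forall>U\<in>\<U>. s \<in> U \<longrightarrow> t \<in> U}"
  by (auto simp: preorder_on_def refl_on_def trans_def)

locale arrow_closed_class = limit_closed_class K
  for K :: "('k, 'p) ring_class" +
  fixes P :: "('p, 'm) ring_scheme"
  assumes ring_P: "ring P"
    and infinite_index: "infinite (UNIV :: 'k set)"
    and arrows: "arrow_incidence_rings P \<subseteq> K"
begin

text \<open>The complement of \<open>U\<close> becomes the primed block and \<open>U\<close> the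
  unprimed one: only pairs leading out of \<open>U\<close> are excluded. For \<open>U = C\<close>
  there are no primed elements and the full matrix ring over \<open>C\<close> results.\<close>

lemma has_copy_two_blocks:
  assumes C: "finite C" and U: "U \<subseteq> C" and q: "q = {(s, t) \<in> C \<times> C. s \<in> U \<longrightarrow> t \<in> U}"
  shows "has_copy (incidence_ring C q P)"
proof -
  have fin: "finite U" "finite (C - U)"
    using C U finite_subset by auto
  define m n where "m = card (C - U)" and "n = card U"
  obtain f where f: "bij_betw f (C - U) {..<m}"
    using ex_bij_betw_finite_nat[OF fin(2)] by (auto simp: m_def atLeast0LessThan)
  obtain g where g: "bij_betw g U {..<n}"
    using ex_bij_betw_finite_nat[OF fin(1)] by (auto simp: n_def atLeast0LessThan)
  define h where "h = (\<lambda>x. if x \<in> U then Inr (g x) else Inl (f x))"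
  have "bij_betw h (C - U) (Inl ` {..<m})" "bij_betw h U (Inr ` {..<n})"
    using f g by (auto simp: bij_betw_def h_def inj_on_def image_iff)
  then have "bij_betw h ((C - U) \<union> U) (Inl ` {..<m} \<union> Inr ` {..<n})"
    by (rule bij_betw_combine) auto
  then have h: "bij_betw h C (arrow_carrier m n)"
    using U by (simp add: arrow_carrier_def Un_absorb2)
  have iff: "(h s, h t) \<in> arrow_rel m n \<longleftrightarrow> (s, t) \<in> q" if "s \<in> C" "t \<in> C" for s t
    using that bij_betwE[OF f] bij_betwE[OF g] by (auto simp: h_def q arrow_rel_def)
  let ?A = "incidence_ring (arrow_carrier m n) (arrow_rel m n) P"
  have fin_arrow: "finite (arrow_carrier m n)"
    by (simp add: arrow_carrier_def)
  note lf = locally_finite_if_finite[OF fin_arrow, of "arrow_rel m n"]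
  have "ring ?A"
    by (intro ring_incidence_ring ring_P preorder_on_arrow_rel lf)
  moreover have "carrier ?A \<lesssim> (UNIV :: ('k \<Rightarrow> 'p) set)"
    by (intro incidence_ring_carrier_lepoll infinite_index
        finite_lepoll_infinite[OF infinite_index fin_arrow])
  ultimately have "(copies ?A :: ('k, 'p) ring_class) \<noteq> {}"
    by (rule copies_nonempty)
  then have "has_copy ?A"
    using arrows by (fastforce simp: has_copy_def arrow_incidence_rings_def copies_def)
  moreover have "?A \<simeq> incidence_ring C q P"
    using preorder_on_respecting[of C "{U}"] h iff
    by (intro incidence_ring_iso[where h = h] ring_P preorder_on_arrow_rel lf
        locally_finite_if_finite[OF C]) (auto simp: q)
  ultimately show ?thesis
    by (rule has_copy_iso)
qed

text \<open>Both rings sit inside the full matrix ring over \<open>C\<close>. A pair of elements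
  with the same image there is a single matrix, vanishing off \<open>q1\<close> and off
  \<open>q2\<close>. The inclusions are instances of \<open>incidence_pull\<close> along the
  identity.\<close>

lemma has_copy_Int:
  assumes C: "finite C" and q1: "preorder_on C q1" and q2: "preorder_on C q2"
    and copy: "has_copy (incidence_ring C q1 P)" "has_copy (incidence_ring C q2 P)"
  shows "has_copy (incidence_ring C (q1 \<inter> q2) P)"
proof -
  note lf = locally_finite_if_finite[OF C]
  have full: "has_copy (incidence_ring C (C \<times> C) P)"
    by (rule has_copy_two_blocks[OF C subset_refl]) auto
  have pre: "preorder_on C (q1 \<inter> q2)" "preorder_on C (C \<times> C)"
    using q1 q2 by (auto simp: preorder_on_def refl_on_def trans_def)
  have hom: "incidence_pull (\<lambda>x. x) C \<in> ring_hom (incidence_ring C r P) (incidence_ring C q P)"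
    if "preorder_on C r" "preorder_on C q" "r \<subseteq> q" for r q
    using that preorder_onD(4)[OF that(1)] by (intro incidence_pull_hom ring_P lf) auto
  have sub: "q1 \<subseteq> C \<times> C" "q2 \<subseteq> C \<times> C"
    using q1 q2 by (auto simp: preorder_on_def)
  show ?thesis
  proof (rule has_copy_pullback[OF _ _ copy full hom hom hom hom])
    show "ring (incidence_ring C (q1 \<inter> q2) P)"
      by (intro ring_incidence_ring ring_P pre lf)
    show "carrier (incidence_ring C (q1 \<inter> q2) P) \<lesssim> (UNIV :: ('k \<Rightarrow> 'p) set)"
      by (intro incidence_ring_carrier_lepoll infinite_index
          finite_lepoll_infinite[OF infinite_index C])
    fix a b
    assume "a \<in> carrier (incidence_ring C q1 P)" "b \<in> carrier (incidence_ring C q2 P)"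
      "incidence_pull (\<lambda>x. x) C a = incidence_pull (\<lambda>x. x) C b"
    moreover from this have "a = b"
      by (simp add: incidence_pull_id)
    ultimately show "\<exists>x\<in>carrier (incidence_ring C (q1 \<inter> q2) P).
        incidence_pull (\<lambda>x. x) C x = a \<and> incidence_pull (\<lambda>x. x) C x = b"
      by (intro bexI[of _ a]) (auto simp: incidence_pull_id incidence_ring_carrier_iff)
  qed (use q1 q2 pre sub in \<open>auto simp: incidence_pull_id\<close>)
qed

lemma has_copy_finite:
  assumes C: "finite C" and r: "preorder_on C r"
  shows "has_copy (incidence_ring C r P)"
proof -
  let ?q = "\<lambda>\<U>. {(s, t) \<in> C \<times> C. \<forall>U\<in>\<U>. s \<in> U \<longrightarrow> t \<in> U}"
  have finite_Int: "has_copy (incidence_ring C (?q \<U>) P)" if "finite \<U>" "\<U> \<subseteq> Pow C" for \<U>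
    using that
  proof (induction \<U>)
    case empty
    show ?case by (rule has_copy_two_blocks[OF C subset_refl]) auto
  next
    case (insert U \<U>)
    have eq: "?q (insert U \<U>) = ?q {U} \<inter> ?q \<U>" by auto
    have "has_copy (incidence_ring C (?q {U}) P)"
      using insert.prems by (intro has_copy_two_blocks[OF C, of U]) auto
    then show ?case
      unfolding eq using insert by (intro has_copy_Int[OF C] preorder_on_respecting) auto
  qed
  \<comment> \<open>A preorder is the intersection of the two-block preorders of its principal up-sets.\<close>
  have "has_copy (incidence_ring C (?q ((\<lambda>x. {t \<in> C. (x, t) \<in> r}) ` C)) P)"
    by (rule finite_Int) (use C in auto)
  \<comment> \<open>Testing the condition on the up-set of \<open>s\<close> itself, which contains
    \<open>s\<close> by reflexivity, yields \<open>(s, t) \<in> r\<close>; the converse is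
    transitivity.\<close>
  also have "?q ((\<lambda>x. {t \<in> C. (x, t) \<in> r}) ` C) = r"
    using preorder_onD[OF r] by auto
  finally show ?thesis .
qed

lemma has_copy_locally_finite:
  assumes r: "preorder_on \<Lambda> r" and lf: "locally_finite \<Lambda> r" and le: "\<Lambda> \<lesssim> (UNIV :: 'k set)"
  shows "has_copy (incidence_ring \<Lambda> r P)"
proof -
  note rD = preorder_onD[OF r]
  define J where "J = {C \<in> Fpow \<Lambda>. \<forall>s\<in>C. \<forall>t\<in>C. proset_interval \<Lambda> r s t \<subseteq> C}"
  have J: "finite C" "C \<subseteq> \<Lambda>" "s \<in> C \<Longrightarrow> t \<in> C \<Longrightarrow> (s, u) \<in> r \<Longrightarrow> (u, t) \<in> r \<Longrightarrow> u \<in> C"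
    if "C \<in> J" for C s t u
    using that rD(4)[of s u] unfolding J_def Fpow_def proset_interval_def by blast+
  have hull: "\<exists>C\<in>J. F \<subseteq> C" if F: "finite F" "F \<subseteq> \<Lambda>" for F
  proof -
    \<comment> \<open>One round of filling in intervals already gives a convex set: by transitivity,
      anything between two points of \<open>H\<close> lies between two points of
      \<open>F\<close>.\<close>
    define H where "H = (\<Union>s\<in>F. \<Union>t\<in>F. proset_interval \<Lambda> r s t)"
    have "x \<in> proset_interval \<Lambda> r x x" if "x \<in> F" for x
      using that F(2) rD(1) by (auto simp: proset_interval_def)
    then have "F \<subseteq> H"
      unfolding H_def by blast
    have "finite H" "H \<subseteq> \<Lambda>"
      using F(1) finite_proset_interval[OF r lf] by (auto simp: H_def proset_interval_def)
    moreover have "proset_interval \<Lambda> r s t \<subseteq> H" if st: "s \<in> H" "t \<in> H" for s t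
    proof
      fix u assume u: "u \<in> proset_interval \<Lambda> r s t"
      obtain a b where "a \<in> F" "b \<in> F" "(a, s) \<in> r" "(t, b) \<in> r"
        using st by (auto simp: H_def proset_interval_def)
      moreover from this have "u \<in> proset_interval \<Lambda> r a b"
        using u rD(2) by (auto simp: proset_interval_def)
      ultimately show "u \<in> H" unfolding H_def by blast
    qed
    ultimately have "H \<in> J"
      by (simp add: J_def Fpow_def)
    with \<open>F \<subseteq> H\<close> show ?thesis by blast
  qed
  have J_le: "J \<lesssim> Fpow \<Lambda>"
    by (rule subset_imp_lepoll) (auto simp: J_def)
  have Fpow_le: "Fpow \<Lambda> \<lesssim> Fpow (UNIV :: 'k set)"
  proof -
    obtain e :: "'a \<Rightarrow> 'k" where "inj_on e \<Lambda>"
      using le by (auto simp: lepoll_def)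
    then have "inj_on ((`) e) (Fpow \<Lambda>)"
      by (rule inj_on_image_Fpow)
    moreover have "(`) e ` Fpow \<Lambda> \<subseteq> Fpow UNIV"
      by (auto simp: Fpow_def)
    ultimately show ?thesis
      unfolding lepoll_def by blast
  qed
  obtain w :: "'a set \<Rightarrow> 'k" where w: "inj_on w J"
    using lepoll_trans[OF lepoll_trans[OF J_le Fpow_le] Fpow_lepoll_infinite[OF infinite_index]]
    by (auto simp: lepoll_def)
  \<comment> \<open>The convex sets are renamed by elements of \<open>'k\<close>, where index sets
    of inverse limits must live; \<open>c\<close> decodes a name.\<close>
  define I where "I = w ` J"
  define c where "c = inv_into J w"
  have c: "c i \<in> J" if "i \<in> I" for i
    using that by (auto simp: I_def c_def w)
  have c_inj: "i = j" if "i \<in> I" "j \<in> I" "c i = c j" for i j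
    using that by (auto simp: I_def c_def w)
  have c_surj: "\<exists>i\<in>I. c i = C" if "C \<in> J" for C
    using that by (auto simp: I_def c_def w)
  have cover: "\<exists>i\<in>I. F \<subseteq> c i" if "finite F" "F \<subseteq> \<Lambda>" for F
    using hull[OF that] c_surj by metis
  define leq where "leq = {(i, j). i \<in> I \<and> j \<in> I \<and> c i \<subseteq> c j}"
  have ub: "\<exists>k\<in>I. (i, k) \<in> leq \<and> (j, k) \<in> leq" if "i \<in> I" "j \<in> I" for i j
  proof -
    have "finite (c i \<union> c j)" "c i \<union> c j \<subseteq> \<Lambda>"
      using J(1,2)[OF c] that by auto
    then obtain k where "k \<in> I" "c i \<union> c j \<subseteq> c k"
      using cover by metis
    then show ?thesis
      using that by (intro bexI[of _ k]) (auto simp: leq_def)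
  qed
  define A where "A = (\<lambda>i. incidence_ring (c i) (r \<inter> c i \<times> c i) P)"
  have pre: "preorder_on (c i) (r \<inter> c i \<times> c i)" if "i \<in> I" for i
    using rD J(2)[OF c[OF that]] by (auto simp: preorder_on_def refl_on_def intro!: transI)
  note lfc = locally_finite_if_finite[OF J(1)[OF c]]
  have Lc: "c i \<subseteq> \<Lambda>" if "i \<in> I" for i
    using J(2) c that by blast
  show ?thesis
  proof (rule has_copy_inverse_limit[where I = I and leq = leq and A = A
        and \<psi> = "\<lambda>i j. incidence_pull (\<lambda>x. x) (c i)" and p = "\<lambda>i. incidence_pull (\<lambda>x. x) (c i)"])
    show "ring (incidence_ring \<Lambda> r P)"
      by (rule ring_incidence_ring[OF ring_P r lf])
    show "carrier (incidence_ring \<Lambda> r P) \<lesssim> (UNIV :: ('k \<Rightarrow> 'p) set)"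
      by (rule incidence_ring_carrier_lepoll[OF infinite_index le])
    \<comment> \<open>Antisymmetry comes from the injectivity of the decoding: indices with the same
      convex set coincide.\<close>
    have "partial_order_on I leq"
      using c_inj by (auto simp: partial_order_on_def preorder_on_def refl_on_def leq_def
          intro!: transI antisymI)
    then show "directed_poset I leq"
      using ub cover[of "{}"] by (auto simp: directed_poset_def)
    show "has_copy (A i)" if "i \<in> I" for i
      unfolding A_def using that by (intro has_copy_finite pre J(1)[OF c])
    show "incidence_pull (\<lambda>x. x) (c i) \<in> ring_hom (A j) (A i)" if ij: "(i, j) \<in> leq" for i j
    proof -
      have "i \<in> I" "j \<in> I" "c i \<subseteq> c j"
        using ij by (auto simp: leq_def)
      then show ?thesis
        unfolding A_def
      proof (intro incidence_pull_hom ring_P pre lfc)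
        \<comment> \<open>Here convexity is used: an index between two elements of
          \<open>c i\<close> already lies in \<open>c i\<close>, so restricting loses no summand of
          a product.\<close>
        fix s t u assume "s \<in> c i" "t \<in> c i" "(s, u) \<in> r \<inter> c j \<times> c j" "(u, t) \<in> r \<inter> c j \<times> c j"
        then show "u \<in> (\<lambda>x. x) ` c i"
          using J(3)[OF c[OF \<open>i \<in> I\<close>], of s t u] by simp
      qed auto
    qed
    show "incidence_pull (\<lambda>x. x) (c i) \<in> ring_hom (incidence_ring \<Lambda> r P) (A i)" if i: "i \<in> I" for i
      unfolding A_def
    proof (intro incidence_pull_hom ring_P r lf pre[OF i] lfc[OF i])
      fix s t u assume "s \<in> c i" "t \<in> c i" "(s, u) \<in> r" "(u, t) \<in> r"
      then show "u \<in> (\<lambda>x. x) ` c i"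
        using J(3)[OF c[OF i], of s t u] by simp
    qed (use Lc[OF i] in auto)
    show "incidence_pull (\<lambda>x. x) (c i) x = x" if "i \<in> I" "x \<in> carrier (A i)" for i x
      using that by (simp add: A_def incidence_pull_id)
    fix x y assume xy: "x \<in> carrier (incidence_ring \<Lambda> r P)" "y \<in> carrier (incidence_ring \<Lambda> r P)"
      and eq: "\<And>i. i \<in> I \<Longrightarrow> incidence_pull (\<lambda>x. x) (c i) x = incidence_pull (\<lambda>x. x) (c i) y"
    show "x = y"
    proof (rule incidence_ring_ext[of _ \<Lambda>])
      fix s t assume "s \<in> \<Lambda>" "t \<in> \<Lambda>"
      then obtain i where "i \<in> I" "s \<in> c i" "t \<in> c i"
        using cover[of "{s, t}"] by auto
      then show "x (s, t) = y (s, t)"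
        using fun_cong[OF eq, of i "(s, t)"] by (simp add: incidence_pull_apply)
    qed (use xy incidence_ring_extensional(1) in auto)
  next
    fix y assume y: "\<And>i. i \<in> I \<Longrightarrow> y i \<in> carrier (A i)"
      and compat: "\<And>i j. (i, j) \<in> leq \<Longrightarrow> incidence_pull (\<lambda>x. x) (c i) (y j) = y i"
    \<comment> \<open>A compatible family is glued entrywise: \<open>k s t\<close> selects some
      piece containing both \<open>s\<close> and \<open>t\<close>, and the entry is read off
      there.\<close>
    define k where "k = (\<lambda>s t. SOME i. i \<in> I \<and> s \<in> c i \<and> t \<in> c i)"
    have k: "k s t \<in> I" "s \<in> c (k s t)" "t \<in> c (k s t)" if "s \<in> \<Lambda>" "t \<in> \<Lambda>" for s t
      using someI_ex[of "\<lambda>i. i \<in> I \<and> s \<in> c i \<and> t \<in> c i"] cover[of "{s, t}"] that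
      unfolding k_def by auto
    have leq_eq: "y i (s, t) = y j (s, t)" if "(i, j) \<in> leq" "s \<in> c i" "t \<in> c i" for i j s t
      using fun_cong[OF compat[OF that(1)], of "(s, t)"] that by (simp add: incidence_pull_apply)
    \<comment> \<open>The choice of piece does not matter, since two pieces lie in a common larger
      one and both entries agree with the entry there.\<close>
    have y_eq: "y i (s, t) = y j (s, t)"
      if "i \<in> I" "j \<in> I" "s \<in> c i" "t \<in> c i" "s \<in> c j" "t \<in> c j" for i j s t
      using ub[OF that(1,2)] leq_eq that by metis
    define x where "x = (\<lambda>(s, t)\<in>\<Lambda> \<times> \<Lambda>. y (k s t) (s, t))"
    have "y (k s t) (s, t) \<in> carrier P" "(s, t) \<notin> r \<Longrightarrow> y (k s t) (s, t) = \<zero>\<^bsub>P\<^esub>"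
      if "s \<in> \<Lambda>" "t \<in> \<Lambda>" for s t
      using incidence_ring_closed[OF y[OF k(1)[OF that], unfolded A_def] k(2,3)[OF that]]
        incidence_ring_eq_zero[OF y[OF k(1)[OF that], unfolded A_def] k(2,3)[OF that]] by auto
    then have "x \<in> carrier (incidence_ring \<Lambda> r P)"
      by (auto simp: incidence_ring_carrier_iff x_def)
    moreover have "incidence_pull (\<lambda>x. x) (c i) x = y i" if i: "i \<in> I" for i
    proof (rule incidence_ring_ext[of _ "c i"])
      fix s t assume st: "s \<in> c i" "t \<in> c i"
      then have "s \<in> \<Lambda>" "t \<in> \<Lambda>" using Lc[OF i] by auto
      then show "incidence_pull (\<lambda>x. x) (c i) x (s, t) = y i (s, t)"
        using st y_eq[OF k(1) i k(2,3) st] by (simp add: incidence_pull_apply x_def)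
    qed (use y[OF i] incidence_ring_extensional(1) in \<open>auto simp: A_def incidence_pull_extensional\<close>)
    ultimately show "\<exists>x\<in>carrier (incidence_ring \<Lambda> r P).
        \<forall>i\<in>I. incidence_pull (\<lambda>x. x) (c i) x = y i"
      by blast
  qed (simp_all add: leq_def incidence_pull_restrict)
qed

end

theorem corollary4p12:
  fixes P :: "('p, 'm) ring_scheme"
    and \<Lambda> :: "'l set"
    and r :: "'l rel"
  assumes "ring P"
    and "partial_order_on \<Lambda> r"
    and "locally_finite \<Lambda> r"
    and "infinite (UNIV :: 'k set)"
    and "\<Lambda> \<lesssim> (UNIV :: 'k set)"
  shows "\<exists>R \<in> generated_class (arrow_incidence_rings P :: ('k, 'p) ring_class).
           R \<simeq> incidence_ring \<Lambda> r P"
proof -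
  let ?M = "incidence_ring \<Lambda> r P"
  have r: "preorder_on \<Lambda> r"
    using assms(2) by (simp add: partial_order_on_def)
  have "ring ?M"
    by (rule ring_incidence_ring[OF assms(1) r assms(3)])
  \<comment> \<open>The representative is fixed before any class \<open>K\<close> is considered,
    because one ring must lie in all of them. Each \<open>K\<close> supplies its own copy
    \<open>R'\<close>, and closure under isomorphism then brings in \<open>R\<close>.\<close>
  then obtain R :: "('k \<Rightarrow> 'p) ring" where R: "ring R" "R \<simeq> ?M"
    using copies_nonempty[OF _ incidence_ring_carrier_lepoll[OF assms(4,5)], of r P]
    by (auto simp: copies_def)
  have "R \<in> K"
    if K: "K \<subseteq> {R. ring R}" "arrow_incidence_rings P \<subseteq> K" "closed_under_iso K"
      "closed_under_inverse_limits K" "closed_under_pullbacks K"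
    for K :: "('k, 'p) ring_class"
  proof -
    interpret arrow_closed_class K P
      using K assms
      by (intro arrow_closed_class.intro limit_closed_class.intro arrow_closed_class_axioms.intro) auto
    obtain R' where R': "R' \<in> K" "R' \<simeq> ?M"
      using has_copy_locally_finite[OF r assms(3,5)] by (auto simp: has_copy_def)
    then have "R \<simeq> R'"
      using R ring_iso_trans ring_iso_sym[of R'] rings by blast
    then show "R \<in> K"
      using R(1) R'(1) K(3) by (auto simp: closed_under_iso_def copies_def)
  qed
  then have "R \<in> generated_class (arrow_incidence_rings P)"
    by (auto simp: generated_class_def)
  with R(2) show ?thesis by blast
qed

end
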